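(* If $G$ is a randomly $k$-dimensional graph of order $n$, then $k\leq 3$ or $k\geq n-1$.
   Context: All graphs are finite, simple and connected. For an ordered set $W=\{w_1,\dots,w_k\}\subseteq V(G)$ and $v\in V(G)$, $r(v|W)=(d(v,w_1),\dots,d(v,w_k))$, where $d$ denotes graph distance. $W$ is a resolving set if distinct vertices have distinct representations with respect to $W$; a basis is a minimum-size resolving set and its size is the metric dimension $\beta(G)$. $G$ is randomly $k$-dimensional if $\beta(G)=k$ and every $k$-subset of $V(G)$ is a basis of $G$. *)

theory Defs
  imports "Graph_Theory.Graph_Theory"
begin

text \<open>Finite simple graphs are the loop-free, symmetric digraphs without parallel arcs of the locale
  \<open>graph\<close>. The graph distance is the shortest-path cost for unit arc weights.\<close>

definition graph_dist :: "('a, 'b) pre_digraph \<Rightarrow> 'a \<Rightarrow> 'a \<Rightarrow> ereal" where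
  "graph_dist G u v = wf_digraph.\<mu> G (\<lambda>_. 1) u v"

lemma (in wf_digraph) graph_dist_eq_INF_length:
  "graph_dist G u v = (INF p\<in>{p. awalk u p v}. ereal (real (length p)))"
proof -
  have "awalk_cost (\<lambda>_. 1) p = real (length p)" for p :: "'b awalk"
    by (induct p) auto
  then show ?thesis
    by (simp add: graph_dist_def \<mu>_def)
qed

definition metric_rep :: "('a, 'b) pre_digraph \<Rightarrow> 'a \<Rightarrow> 'a list \<Rightarrow> ereal list" where
  "metric_rep G v ws = map (graph_dist G v) ws"

text \<open>The ordering \<open>ws\<close> of \<open>W\<close> is immaterial: a permutation of \<open>ws\<close> permutes all representations
  alike.\<close>

definition resolving_set :: "('a, 'b) pre_digraph \<Rightarrow> 'a set \<Rightarrow> bool" where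
  "resolving_set G W \<longleftrightarrow> W \<subseteq> verts G \<and>
    (\<exists>ws. distinct ws \<and> set ws = W \<and> inj_on (\<lambda>v. metric_rep G v ws) (verts G))"

definition metric_basis :: "('a, 'b) pre_digraph \<Rightarrow> 'a set \<Rightarrow> bool" where
  "metric_basis G W \<longleftrightarrow> is_arg_min card (resolving_set G) W"

definition metric_dimension :: "('a, 'b) pre_digraph \<Rightarrow> nat" where
  "metric_dimension G = (LEAST k. \<exists>W. resolving_set G W \<and> card W = k)"

definition randomly_dimensional :: "nat \<Rightarrow> ('a, 'b) pre_digraph \<Rightarrow> bool" where
  "randomly_dimensional k G \<longleftrightarrow>
    metric_dimension G = k \<and> (\<forall>W \<subseteq> verts G. card W = k \<longrightarrow> metric_basis G W)"

end

theory Submission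
  imports Defs
begin

text \<open>A pair of distinct vertices leaves at most \<open>k - 1\<close> vertices unable to resolve it, since every
  \<open>k\<close>-set resolves, while every \<open>(k - 1)\<close>-set fails to resolve some pair. Hence every
  \<open>(k - 1)\<close>-set is exactly the non-resolving set of some pair, so there are at least as many pairs
  as \<open>(k - 1)\<close>-sets, which is impossible for \<open>3 \<le> k - 1 \<le> n - 3\<close>.\<close>

lemma resolving_set_iff:
  assumes "finite (verts G)" "W \<subseteq> verts G"
  shows "resolving_set G W \<longleftrightarrow>
    (\<forall>u\<in>verts G. \<forall>v\<in>verts G. (\<forall>w\<in>W. graph_dist G u w = graph_dist G v w) \<longrightarrow> u = v)"
proof -
  obtain ws where "set ws = W" "distinct ws"
    using finite_distinct_list finite_subset assms by metis
  then show ?thesis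
    using assms(2) unfolding resolving_set_def inj_on_def metric_rep_def map_eq_conv by blast
qed

text \<open>Taking a set \<open>P\<close> instead of two vertices makes the pairs unordered, so that
  their number is \<open>n choose 2\<close>.\<close>

definition nonresolving :: "('a, 'b) pre_digraph \<Rightarrow> 'a set \<Rightarrow> 'a set" where
  "nonresolving G P = {w \<in> verts G. \<forall>x\<in>P. \<forall>y\<in>P. graph_dist G x w = graph_dist G y w}"

lemma randomly_dimensional_eq_nonresolving:
  assumes fin: "finite (verts G)" and rd: "randomly_dimensional k G"
    and S: "S \<subseteq> verts G" "Suc (card S) = k"
  obtains u v where "u \<in> verts G" "v \<in> verts G" "u \<noteq> v" "S = nonresolving G {u, v}"
proof -
  \<comment> \<open>\<open>S\<close> has \<open>k - 1\<close> elements, one fewer than the least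
    size of a resolving set.\<close>
  have "\<not> resolving_set G S"
    using rd S(2) unfolding randomly_dimensional_def metric_dimension_def
    by (metis (mono_tags, lifting) lessI not_less_Least)
  then obtain u v where uv: "u \<in> verts G" "v \<in> verts G" "u \<noteq> v"
    "\<forall>w\<in>S. graph_dist G u w = graph_dist G v w"
    using resolving_set_iff[OF fin S(1)] by blast
  let ?N = "nonresolving G {u, v}"
  have sub: "S \<subseteq> ?N" and finN: "finite ?N"
    using uv S(1) fin by (auto simp: nonresolving_def)
  have "card ?N < k"
  proof (rule ccontr)
    assume "\<not> card ?N < k"
    then obtain W where W: "W \<subseteq> ?N" "card W = k"
      by (meson not_less obtain_subset_with_card_n)
    then have WV: "W \<subseteq> verts G" by (auto simp: nonresolving_def)
    then have "resolving_set G W"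
      using rd W(2) by (auto simp: randomly_dimensional_def metric_basis_def is_arg_min_def)
    moreover have "\<forall>w\<in>W. graph_dist G u w = graph_dist G v w"
      using W(1) by (auto simp: nonresolving_def)
    ultimately show False
      using resolving_set_iff[OF fin WV] uv by blast
  qed
  then have "S = ?N"
    using card_seteq[OF finN sub] S(2) by simp
  with uv that show thesis by blast
qed

text \<open>A row of Pascal's triangle strictly rises up to its middle and strictly falls after it,
  and \<open>j\<close> lies strictly between 2 and its mirror index \<open>n - 2\<close>.\<close>

lemma binomial_2_less:
  assumes "3 \<le> j" "j + 3 \<le> n"
  shows "n choose 2 < n choose j"
proof (cases "2 * j \<le> n")
  case True
  then show ?thesis
    using assms by (intro binomial_strict_mono) auto
next
  case False
  \<comment> \<open>Right of the middle the comparison is with \<open>n - 2\<close>, whose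
    coefficient equals \<open>n choose 2\<close> by symmetry.\<close>
  then have "n choose (n - 2) < n choose j"
    using assms by (intro binomial_strict_antimono) auto
  then show ?thesis
    using assms binomial_symmetric[of 2 n] by simp
qed

theorem mainTheorem4:
  fixes G :: "('a, 'b) pre_digraph" and k n :: nat
  assumes "graph G"
    and "Digraph_Component.connected G"
    and "card (verts G) = n"
    and "randomly_dimensional k G"
  shows "k \<le> 3 \<or> k \<ge> n - 1"
proof (rule ccontr)
  assume "\<not> (k \<le> 3 \<or> k \<ge> n - 1)"
  \<comment> \<open>The negation says 4 \<le> \<open>k\<close> \<le> \<open>n - 2\<close>, so
    \<open>k - 1\<close> is a true difference.\<close>
  then have k: "3 \<le> k - 1" "k - 1 + 3 \<le> n" by auto
  interpret graph G by fact
  have fin: "finite (verts G)" by simp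
  let ?pairs = "{P. P \<subseteq> verts G \<and> card P = 2}"
  have "{S. S \<subseteq> verts G \<and> card S = k - 1} \<subseteq> nonresolving G ` ?pairs"
  proof safe
    fix S assume "S \<subseteq> verts G" "card S = k - 1"
    with k obtain u v where "u \<in> verts G" "v \<in> verts G" "u \<noteq> v" "S = nonresolving G {u, v}"
      using randomly_dimensional_eq_nonresolving[OF fin assms(4), of S] by auto
    then show "S \<in> nonresolving G ` ?pairs" by auto
  qed
  moreover have "finite ?pairs" using fin by simp
  ultimately have "card {S. S \<subseteq> verts G \<and> card S = k - 1} \<le> card ?pairs"
    by (rule surj_card_le[rotated])
  then have "n choose (k - 1) \<le> n choose 2"
    using n_subsets[OF fin] assms(3) by simp
  with binomial_2_less[OF k] show False by simp
qed

end
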